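(* Let $(\Gamma,v_0)$ be a pointed graph satisfying the following two conditions: (S1) for every $i\in I(\Gamma,v_0)$ and all $v,w\in V$, $|S_i(v)|=|S_i(w)|$; (S2) for all $i,j,k\in I(\Gamma,v_0)$ and all $v,w\in S_k(v_0)$, $|S_i(v)\cap S_j(v_0)|=|S_i(w)\cap S_j(v_0)|$. If the $k$-adjacency matrices associated with $\Gamma$ mutually commute, i.e. $A^{(k)}A^{(l)}=A^{(l)}A^{(k)}$ for all $k,l\in I(\Gamma,v_0)$, then $(\Gamma,v_0)$ is hypergroup productive.
   Context: All graphs $\Gamma$, with vertex set $V$, are simple, connected, locally finite, self-centered (all vertices have the same eccentricity, possibly infinite), and have at most countably many (possibly infinitely many) vertices. $d$ is the graph distance on $V$. A pointed graph $(\Gamma,v_0)$ is a graph with a chosen base point $v_0\in V$. For $v\in V$ and $k\in\mathbb{N}_0$, $S_k(v)=\{w\in V: d(v,w)=k\}$. Put $I(\Gamma,v_0)=\{d(v_0,v): v\in V\}$, which equals $\{0,1,\dots,\mathrm{diam}(\Gamma)\}$ if $V$ is finite and $\mathbb{N}_0$ if $V$ is infinite. $k$-adjacency matrix: for $k\in I(\Gamma,v_0)$, $A^{(k)}=(\delta_{k,d(x,y)})_{x,y\in V}$ ($\delta$ is the Kronecker delta). By local finiteness each row and column has finitely many nonzero entries, so products are well defined. The algebra $H(\Gamma,v_0)$: let $H(\Gamma,v_0)=\{x_i\}_{i\in I(\Gamma,v_0)}$ be a set of indeterminates and $\mathbb{C}H(\Gamma,v_0)$ the free complex vector space on it. Define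 a bilinear operation (convolution) $\circ$ on $\mathbb{C}H(\Gamma,v_0)$ by $x_i\circ x_j=\sum_{k\in I(\Gamma,v_0)}p_{i,j}^k x_k$, where $$p_{i,j}^k=\frac{1}{|S_i(v_0)|}\sum_{v\in S_i(v_0)}\frac{|S_j(v)\cap S_k(v_0)|}{|S_j(v)|}.$$ Let $*$ be the conjugate-linear extension to $\mathbb{C}H(\Gamma,v_0)$ of the identity map on $H(\Gamma,v_0)$. Hermitian hypergroup: let $H=\{x_i\}_{i\in I}$ with $I=\{0,\dots,N\}$ or $I=\mathbb{N}_0$. A triple $(H,\circ,* )$, with $\circ:\mathbb{C}H\times\mathbb{C}H\to\mathbb{C}H$ and $*:\mathbb{C}H\to\mathbb{C}H$, is a discrete hypergroup if (1) $(\mathbb{C}H,\circ,* )$ is an (associative) $*$-algebra with unit $x_0$; (2) $*$ maps $H$ onto $H$; (3) writing $x_i\circ x_j=\sum_k q_{i,j}^k x_k$, one has $q_{i,j}^k\ge 0$, $\sum_k q_{i,j}^k=1$, and $q_{i,j}^0\ne 0$ if and only if $x_i=x_j^*$. It is hermitian if $*|_H$ is the identity map (then it is automatically commutative). $(\Gamma,v_0)$ is hypergroup productive if $(H(\Gamma,v_0),\circ,* )$ is a hermitian (discrete) hypergroup. *)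

theory Defs
  imports Complex_Main
    "HOL-Library.Countable_Set"
    "HOL-Library.Extended_Nat"
    "HOL-Library.Nonpos_Ints"
    "HOL-Library.Poly_Mapping"
begin

section \<open>Pointed graphs\<close>

text \<open>
  A simple graph is given by its vertex set \<open>V\<close> and its adjacency relation \<open>E\<close>, a symmetric and
  irreflexive relation on \<open>V\<close>; the walks of length \<open>n\<close> from \<open>x\<close> to \<open>y\<close> are witnessed by
  \<open>(x, y) \<in> E ^^ n\<close>.
\<close>

definition graph_dist :: "('a \<times> 'a) set \<Rightarrow> 'a \<Rightarrow> 'a \<Rightarrow> nat" where
  "graph_dist E x y = (LEAST n. (x, y) \<in> E ^^ n)"

definition eccentricity :: "'a set \<Rightarrow> ('a \<times> 'a) set \<Rightarrow> 'a \<Rightarrow> enat" where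
  "eccentricity V E v = (SUP w\<in>V. enat (graph_dist E v w))"

locale pointed_graph =
  fixes V :: "'a set" and E :: "('a \<times> 'a) set" and v0 :: 'a
  assumes edges: "E \<subseteq> V \<times> V"
    and symmetric: "sym E"
    and loopfree: "irrefl E"
    and base_point: "v0 \<in> V"
    and countable_vertices: "countable V"
    and connected: "\<And>x y. x \<in> V \<Longrightarrow> y \<in> V \<Longrightarrow> (x, y) \<in> E\<^sup>*"
    and locally_finite: "\<And>x. x \<in> V \<Longrightarrow> finite (E `` {x})"
    and self_centered:
      "\<And>x y. x \<in> V \<Longrightarrow> y \<in> V \<Longrightarrow> eccentricity V E x = eccentricity V E y"

definition sphere :: "'a set \<Rightarrow> ('a \<times> 'a) set \<Rightarrow> nat \<Rightarrow> 'a \<Rightarrow> 'a set" where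
  "sphere V E k v = {w \<in> V. graph_dist E v w = k}"

definition dist_indices :: "'a set \<Rightarrow> ('a \<times> 'a) set \<Rightarrow> 'a \<Rightarrow> nat set" where
  "dist_indices V E v0 = graph_dist E v0 ` V"


section \<open>Distance matrices\<close>

text \<open>
  A matrix indexed by \<open>V \<times> V\<close> is a function of two arguments, of which only the values on \<open>V\<close>
  matter. The product is meant for matrices with finitely many nonzero entries in each row and
  column. As \<open>V\<close> may be infinite, its sums range over the nonzero terms only.
\<close>

definition adjacency_matrix :: "('a \<times> 'a) set \<Rightarrow> nat \<Rightarrow> 'a \<Rightarrow> 'a \<Rightarrow> complex" where
  "adjacency_matrix E k x y = (if graph_dist E x y = k then 1 else 0)"

definition matrix_product ::
    "'a set \<Rightarrow> ('a \<Rightarrow> 'a \<Rightarrow> complex) \<Rightarrow> ('a \<Rightarrow> 'a \<Rightarrow> complex) \<Rightarrow> 'a \<Rightarrow> 'a \<Rightarrow> complex" where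
  "matrix_product V A B x y = (\<Sum>z \<in> {z \<in> V. A x z * B z y \<noteq> 0}. A x z * B z y)"

definition matrices_commute ::
    "'a set \<Rightarrow> ('a \<Rightarrow> 'a \<Rightarrow> complex) \<Rightarrow> ('a \<Rightarrow> 'a \<Rightarrow> complex) \<Rightarrow> bool" where
  "matrices_commute V A B \<longleftrightarrow>
    (\<forall>x\<in>V. \<forall>y\<in>V. matrix_product V A B x y = matrix_product V B A x y)"


section \<open>Discrete hypergroups\<close>

text \<open>
  The free complex vector space on \<open>{x\<^sub>i | i \<in> I}\<close> consists of the finitely supported
  functions vanishing outside \<open>I\<close>. The multiplication that \<^theory>\<open>HOL-Library.Poly_Mapping\<close>
  puts on \<^typ>\<open>nat \<Rightarrow>\<^sub>0 complex\<close> plays no role here.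
\<close>

definition free_space :: "nat set \<Rightarrow> (nat \<Rightarrow>\<^sub>0 complex) set" where
  "free_space I = {f. Poly_Mapping.keys f \<subseteq> I}"

definition gen :: "nat \<Rightarrow> (nat \<Rightarrow>\<^sub>0 complex)" where
  "gen i = Poly_Mapping.single i 1"

definition scale :: "complex \<Rightarrow> (nat \<Rightarrow>\<^sub>0 complex) \<Rightarrow> (nat \<Rightarrow>\<^sub>0 complex)" where
  "scale c f = Poly_Mapping.map (\<lambda>z. c * z) f"

locale star_algebra =
  fixes I :: "nat set"
    and mult :: "(nat \<Rightarrow>\<^sub>0 complex) \<Rightarrow> (nat \<Rightarrow>\<^sub>0 complex) \<Rightarrow> (nat \<Rightarrow>\<^sub>0 complex)"
    and star :: "(nat \<Rightarrow>\<^sub>0 complex) \<Rightarrow> (nat \<Rightarrow>\<^sub>0 complex)"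
    and unit :: "nat \<Rightarrow>\<^sub>0 complex"
  assumes mult_closed: "\<lbrakk>f \<in> free_space I; g \<in> free_space I\<rbrakk> \<Longrightarrow> mult f g \<in> free_space I"
    and mult_add_left: "\<lbrakk>f \<in> free_space I; g \<in> free_space I; h \<in> free_space I\<rbrakk>
      \<Longrightarrow> mult (f + g) h = mult f h + mult g h"
    and mult_add_right: "\<lbrakk>f \<in> free_space I; g \<in> free_space I; h \<in> free_space I\<rbrakk>
      \<Longrightarrow> mult f (g + h) = mult f g + mult f h"
    and mult_scale_left: "\<lbrakk>f \<in> free_space I; g \<in> free_space I\<rbrakk>
      \<Longrightarrow> mult (scale c f) g = scale c (mult f g)"
    and mult_scale_right: "\<lbrakk>f \<in> free_space I; g \<in> free_space I\<rbrakk>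
      \<Longrightarrow> mult f (scale c g) = scale c (mult f g)"
    and mult_assoc: "\<lbrakk>f \<in> free_space I; g \<in> free_space I; h \<in> free_space I\<rbrakk>
      \<Longrightarrow> mult (mult f g) h = mult f (mult g h)"
    and unit_closed: "unit \<in> free_space I"
    and unit_left: "f \<in> free_space I \<Longrightarrow> mult unit f = f"
    and unit_right: "f \<in> free_space I \<Longrightarrow> mult f unit = f"
    and star_closed: "f \<in> free_space I \<Longrightarrow> star f \<in> free_space I"
    and star_add: "\<lbrakk>f \<in> free_space I; g \<in> free_space I\<rbrakk> \<Longrightarrow> star (f + g) = star f + star g"
    and star_scale: "f \<in> free_space I \<Longrightarrow> star (scale c f) = scale (cnj c) (star f)"
    and star_star: "f \<in> free_space I \<Longrightarrow> star (star f) = f"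
    and star_mult: "\<lbrakk>f \<in> free_space I; g \<in> free_space I\<rbrakk>
      \<Longrightarrow> star (mult f g) = mult (star g) (star f)"

locale discrete_hypergroup = star_algebra I mult star "gen 0"
  for I :: "nat set"
    and mult :: "(nat \<Rightarrow>\<^sub>0 complex) \<Rightarrow> (nat \<Rightarrow>\<^sub>0 complex) \<Rightarrow> (nat \<Rightarrow>\<^sub>0 complex)"
    and star :: "(nat \<Rightarrow>\<^sub>0 complex) \<Rightarrow> (nat \<Rightarrow>\<^sub>0 complex)" +
  assumes index_set: "(\<exists>N. I = {0..N}) \<or> I = UNIV"
    and star_onto: "star ` gen ` I = gen ` I"
    and coeff_nonneg: "\<lbrakk>i \<in> I; j \<in> I; k \<in> I\<rbrakk>
      \<Longrightarrow> Poly_Mapping.lookup (mult (gen i) (gen j)) k \<in> \<real>\<^sub>\<ge>\<^sub>0"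
    and coeff_sum: "\<lbrakk>i \<in> I; j \<in> I\<rbrakk>
      \<Longrightarrow> (\<Sum>k \<in> Poly_Mapping.keys (mult (gen i) (gen j)).
            Poly_Mapping.lookup (mult (gen i) (gen j)) k) = 1"
    and coeff_0: "\<lbrakk>i \<in> I; j \<in> I\<rbrakk>
      \<Longrightarrow> Poly_Mapping.lookup (mult (gen i) (gen j)) 0 \<noteq> 0 \<longleftrightarrow> gen i = star (gen j)"

locale hermitian_hypergroup = discrete_hypergroup +
  assumes hermitian: "i \<in> I \<Longrightarrow> star (gen i) = gen i"


section \<open>The convolution of a pointed graph\<close>

definition conv_coeff ::
    "'a set \<Rightarrow> ('a \<times> 'a) set \<Rightarrow> 'a \<Rightarrow> nat \<Rightarrow> nat \<Rightarrow> nat \<Rightarrow> real" where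
  "conv_coeff V E v0 i j k =
    1 / real (card (sphere V E i v0)) *
    (\<Sum>v \<in> sphere V E i v0.
      real (card (sphere V E j v \<inter> sphere V E k v0)) / real (card (sphere V E j v)))"

text \<open>
  The index set may be infinite, but for given \<open>i\<close> and \<open>j\<close> only the indices \<open>k \<le> i + j\<close> can
  contribute; the sum is therefore taken over the nonzero terms.
\<close>

definition gen_conv ::
    "'a set \<Rightarrow> ('a \<times> 'a) set \<Rightarrow> 'a \<Rightarrow> nat \<Rightarrow> nat \<Rightarrow> (nat \<Rightarrow>\<^sub>0 complex)" where
  "gen_conv V E v0 i j =
    (\<Sum>k \<in> {k \<in> dist_indices V E v0. conv_coeff V E v0 i j k \<noteq> 0}.
      scale (complex_of_real (conv_coeff V E v0 i j k)) (gen k))"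

definition conv :: "'a set \<Rightarrow> ('a \<times> 'a) set \<Rightarrow> 'a
    \<Rightarrow> (nat \<Rightarrow>\<^sub>0 complex) \<Rightarrow> (nat \<Rightarrow>\<^sub>0 complex) \<Rightarrow> (nat \<Rightarrow>\<^sub>0 complex)" where
  "conv V E v0 f g =
    (\<Sum>i \<in> Poly_Mapping.keys f. \<Sum>j \<in> Poly_Mapping.keys g.
      scale (Poly_Mapping.lookup f i * Poly_Mapping.lookup g j) (gen_conv V E v0 i j))"

definition conj_star :: "(nat \<Rightarrow>\<^sub>0 complex) \<Rightarrow> (nat \<Rightarrow>\<^sub>0 complex)" where
  "conj_star f = (\<Sum>i \<in> Poly_Mapping.keys f. scale (cnj (Poly_Mapping.lookup f i)) (gen i))"

definition hypergroup_productive :: "'a set \<Rightarrow> ('a \<times> 'a) set \<Rightarrow> 'a \<Rightarrow> bool" where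
  "hypergroup_productive V E v0 \<longleftrightarrow>
    hermitian_hypergroup (dist_indices V E v0) (conv V E v0) conj_star"

end

theory Submission
  imports Defs
begin

text \<open>
  Write \<open>n\<^sub>i = |S\<^sub>i|\<close>. By (S2) and double counting, \<open>p\<^sub>i\<^sub>j\<^sup>k = n\<^sub>k |S\<^sub>j(w) \<inter> S\<^sub>i(v\<^sub>0)| / (n\<^sub>i n\<^sub>j)\<close> for every
  \<open>w \<in> S\<^sub>k(v\<^sub>0)\<close>. As \<open>|S\<^sub>j(w) \<inter> S\<^sub>i(v\<^sub>0)|\<close> is the entry of \<open>A\<^sup>(\<^sup>i\<^sup>) A\<^sup>(\<^sup>j\<^sup>)\<close> at \<open>(v\<^sub>0, w)\<close>, the convolution is
  commutative. Right convolution by \<open>x\<^sub>j\<close> is the action of \<open>A\<^sup>(\<^sup>j\<^sup>) / n\<^sub>j\<close> on the normalised indicators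
  of the spheres around \<open>v\<^sub>0\<close>, so \<open>(x\<^sub>i \<circ> x\<^sub>j) \<circ> x\<^sub>l = (x\<^sub>i \<circ> x\<^sub>l) \<circ> x\<^sub>j\<close>; together with commutativity this
  is associativity.
\<close>

section \<open>The free space\<close>

lemma lookup_scale [simp]: "Poly_Mapping.lookup (scale c f) k = c * Poly_Mapping.lookup f k"
  by (auto simp: scale_def Poly_Mapping.map.rep_eq when_def)

lemma lookup_gen: "Poly_Mapping.lookup (gen i) k = (if k = i then 1 else 0)"
  by (auto simp: gen_def lookup_single when_def)

lemma keys_gen [simp]: "Poly_Mapping.keys (gen i) = {i}"
  by (simp add: gen_def)

lemma gen_eq_iff [simp]: "gen i = gen j \<longleftrightarrow> i = j"
  by (metis keys_gen singleton_inject)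

lemma gen_in_free_space [simp]: "gen i \<in> free_space I \<longleftrightarrow> i \<in> I"
  by (simp add: free_space_def)

lemma in_free_space_iff: "f \<in> free_space I \<longleftrightarrow> (\<forall>k. k \<notin> I \<longrightarrow> Poly_Mapping.lookup f k = 0)"
  by (auto simp: free_space_def in_keys_iff)

lemma poly_mapping_eq_sum_gen:
  "f = (\<Sum>i\<in>Poly_Mapping.keys f. scale (Poly_Mapping.lookup f i) (gen i))"
  by (rule poly_mapping_eqI)
     (simp add: lookup_sum lookup_gen if_distrib in_keys_iff cong: if_cong)

text \<open>Reduces identities that are linear in an argument to the generators: a property closed
  under linear combinations spreads from the \<open>gen i\<close> to all of
  \<open>free_space I\<close>.\<close>

lemma free_space_induct [consumes 1, case_names zero add scale gen]:
  assumes "f \<in> free_space I"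
    and zero: "Q 0"
    and add: "\<And>f g. f \<in> free_space I \<Longrightarrow> g \<in> free_space I \<Longrightarrow> Q f \<Longrightarrow> Q g \<Longrightarrow> Q (f + g)"
    and scale: "\<And>c f. f \<in> free_space I \<Longrightarrow> Q f \<Longrightarrow> Q (scale c f)"
    and gen: "\<And>i. i \<in> I \<Longrightarrow> Q (gen i)"
  shows "Q f"
proof -
  \<comment> \<open>Membership of the partial sums is carried through the induction because
    \<open>add\<close> asks for it.\<close>
  have "Q (\<Sum>i\<in>A. scale (h i) (gen i)) \<and> (\<Sum>i\<in>A. scale (h i) (gen i)) \<in> free_space I"
    if "finite A" "A \<subseteq> I" for A and h :: "nat \<Rightarrow> complex"
    using that
  proof (induction A rule: finite_induct)
    case empty
    then show ?case by (simp add: zero in_free_space_iff)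
  next
    case (insert a A)
    have "scale (h a) (gen a) \<in> free_space I"
      using insert.prems by (auto simp: in_free_space_iff lookup_gen)
    then show ?case
      using insert
      by (auto simp: in_free_space_iff lookup_add lookup_gen intro!: add scale gen)
  qed
  from this[of "Poly_Mapping.keys f" "Poly_Mapping.lookup f"] show ?thesis
    using assms(1) by (simp add: free_space_def flip: poly_mapping_eq_sum_gen)
qed

lemma lookup_conj_star [simp]:
  "Poly_Mapping.lookup (conj_star f) k = cnj (Poly_Mapping.lookup f k)"
  by (simp add: conj_star_def lookup_sum lookup_gen if_distrib in_keys_iff cong: if_cong)

lemma conj_star_gen [simp]: "conj_star (gen i) = gen i"
  by (rule poly_mapping_eqI) (simp add: lookup_gen)

lemma conj_star_add: "conj_star (f + g) = conj_star f + conj_star g"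
  by (rule poly_mapping_eqI) (simp add: lookup_add)

lemma conj_star_scale: "conj_star (scale c f) = scale (cnj c) (conj_star f)"
  by (rule poly_mapping_eqI) simp

lemma conj_star_free_space [simp]: "conj_star f \<in> free_space I \<longleftrightarrow> f \<in> free_space I"
  by (simp add: in_free_space_iff)

section \<open>Bilinearity of the convolution\<close>

text \<open>Indices outside the supports contribute zero. The freedom in \<open>A\<close> and
  \<open>B\<close> lets \<open>f\<close>, \<open>g\<close> and \<open>f + g\<close> be expanded over
  one common index set, although cancellation may shrink the support of
  \<open>f + g\<close>.\<close>

lemma conv_eq_sum:
  assumes "finite A" "finite B" "Poly_Mapping.keys f \<subseteq> A" "Poly_Mapping.keys g \<subseteq> B"
  shows "conv V E v0 f g = (\<Sum>i\<in>A. \<Sum>j\<in>B.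
    scale (Poly_Mapping.lookup f i * Poly_Mapping.lookup g j) (gen_conv V E v0 i j))"
proof -
  have z: "scale 0 h = 0" for h by (rule poly_mapping_eqI) simp
  have "conv V E v0 f g = (\<Sum>i\<in>Poly_Mapping.keys f. \<Sum>j\<in>B.
      scale (Poly_Mapping.lookup f i * Poly_Mapping.lookup g j) (gen_conv V E v0 i j))"
    unfolding conv_def
    by (intro sum.cong refl sum.mono_neutral_left) (use assms in \<open>auto simp: in_keys_iff z\<close>)
  also have "\<dots> = (\<Sum>i\<in>A. \<Sum>j\<in>B.
      scale (Poly_Mapping.lookup f i * Poly_Mapping.lookup g j) (gen_conv V E v0 i j))"
    by (intro sum.mono_neutral_left) (use assms in \<open>auto simp: in_keys_iff z\<close>)
  finally show ?thesis .
qed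

lemma lookup_conv_eq_sum:
  assumes "finite A" "finite B" "Poly_Mapping.keys f \<subseteq> A" "Poly_Mapping.keys g \<subseteq> B"
  shows "Poly_Mapping.lookup (conv V E v0 f g) k = (\<Sum>i\<in>A. \<Sum>j\<in>B.
    Poly_Mapping.lookup f i * Poly_Mapping.lookup g j * Poly_Mapping.lookup (gen_conv V E v0 i j) k)"
  by (simp add: conv_eq_sum[OF assms] lookup_sum)

lemma conv_gen_gen [simp]: "conv V E v0 (gen i) (gen j) = gen_conv V E v0 i j"
  by (rule poly_mapping_eqI) (simp add: conv_def lookup_gen)

lemma conv_zero_left [simp]: "conv V E v0 0 g = 0"
  by (simp add: conv_def)

lemma conv_zero_right [simp]: "conv V E v0 f 0 = 0"
  by (simp add: conv_def)

lemma conv_add_left: "conv V E v0 (f + g) h = conv V E v0 f h + conv V E v0 g h"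
proof (rule poly_mapping_eqI)
  fix k
  let ?A = "Poly_Mapping.keys f \<union> Poly_Mapping.keys g"
  show "Poly_Mapping.lookup (conv V E v0 (f + g) h) k =
      Poly_Mapping.lookup (conv V E v0 f h + conv V E v0 g h) k"
    unfolding lookup_add[of "conv V E v0 f h"]
    by (subst (1 2 3) lookup_conv_eq_sum[of ?A "Poly_Mapping.keys h"])
       (simp_all add: keys_add lookup_add distrib_right sum.distrib)
qed

lemma conv_add_right: "conv V E v0 f (g + h) = conv V E v0 f g + conv V E v0 f h"
proof (rule poly_mapping_eqI)
  fix k
  let ?B = "Poly_Mapping.keys g \<union> Poly_Mapping.keys h"
  show "Poly_Mapping.lookup (conv V E v0 f (g + h)) k =
      Poly_Mapping.lookup (conv V E v0 f g + conv V E v0 f h) k"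
    unfolding lookup_add[of "conv V E v0 f g"]
    by (subst (1 2 3) lookup_conv_eq_sum[of "Poly_Mapping.keys f" ?B])
       (simp_all add: keys_add lookup_add distrib_right distrib_left sum.distrib)
qed

lemma conv_scale_left: "conv V E v0 (scale c f) g = scale c (conv V E v0 f g)"
proof (rule poly_mapping_eqI)
  fix k
  show "Poly_Mapping.lookup (conv V E v0 (scale c f) g) k =
      Poly_Mapping.lookup (scale c (conv V E v0 f g)) k"
    unfolding lookup_scale
    by (subst (1 2) lookup_conv_eq_sum[of "Poly_Mapping.keys f" "Poly_Mapping.keys g"])
       (auto simp: in_keys_iff sum_distrib_left mult_ac)
qed

lemma conv_scale_right: "conv V E v0 f (scale c g) = scale c (conv V E v0 f g)"
proof (rule poly_mapping_eqI)
  fix k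
  show "Poly_Mapping.lookup (conv V E v0 f (scale c g)) k =
      Poly_Mapping.lookup (scale c (conv V E v0 f g)) k"
    unfolding lookup_scale
    by (subst (1 2) lookup_conv_eq_sum[of "Poly_Mapping.keys f" "Poly_Mapping.keys g"])
       (auto simp: in_keys_iff sum_distrib_left mult_ac)
qed

lemma scale_add: "scale c (f + g) = scale c f + scale c g"
  by (rule poly_mapping_eqI) (simp add: lookup_add algebra_simps)

lemmas conv_linear_simps =
  conv_add_left conv_add_right conv_scale_left conv_scale_right scale_add

section \<open>Distances and spheres\<close>

context pointed_graph
begin

abbreviation "I \<equiv> dist_indices V E v0"
abbreviation "d \<equiv> graph_dist E"
abbreviation "S \<equiv> sphere V E"
abbreviation "p \<equiv> conv_coeff V E v0"

lemma walk_dist: "x \<in> V \<Longrightarrow> y \<in> V \<Longrightarrow> (x, y) \<in> E ^^ d x y"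
  unfolding graph_dist_def
  by (rule LeastI_ex) (use connected in \<open>auto simp: rtrancl_power\<close>)

lemma dist_le_walk: "(x, y) \<in> E ^^ n \<Longrightarrow> d x y \<le> n"
  unfolding graph_dist_def by (rule Least_le)

lemma walk_commute: "(x, y) \<in> E ^^ n \<Longrightarrow> (y, x) \<in> E ^^ n"
proof (induction n arbitrary: y)
  case (Suc n)
  then obtain z where "(x, z) \<in> E ^^ n" "(z, y) \<in> E" by auto
  then show ?case
    using Suc.IH symmetric by (metis relpow_Suc_I2 symD)
qed auto

lemma dist_commute: "d x y = d y x"
  unfolding graph_dist_def by (metis walk_commute)

lemma dist_self [simp]: "d x x = 0"
  using dist_le_walk[of x x 0] by simp

lemma dist_eq_0_iff: "x \<in> V \<Longrightarrow> y \<in> V \<Longrightarrow> d x y = 0 \<longleftrightarrow> x = y"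
  using walk_dist[of x y] by auto

text \<open>Each further step takes a finite union of neighbourhoods. The inclusion in
  \<open>V\<close> is proved alongside, since local finiteness is given only for vertices.\<close>

lemma finite_walk_ends: "x \<in> V \<Longrightarrow> finite {y. (x, y) \<in> E ^^ n} \<and> {y. (x, y) \<in> E ^^ n} \<subseteq> V"
proof (induction n)
  case (Suc n)
  have "{y. (x, y) \<in> E ^^ Suc n} = (\<Union>z\<in>{z. (x, z) \<in> E ^^ n}. E `` {z})" by auto
  then show ?case
    using Suc edges locally_finite by auto
qed auto

lemma finite_sphere [simp]: "x \<in> V \<Longrightarrow> finite (S k x)"
  by (rule finite_subset[OF _ conjunct1[OF finite_walk_ends[of x k]]])
     (auto simp: sphere_def walk_dist)

lemma sphere_subset: "S k x \<subseteq> V"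
  by (auto simp: sphere_def)

lemma in_sphere_iff: "y \<in> S k x \<longleftrightarrow> y \<in> V \<and> d x y = k"
  by (auto simp: sphere_def)

lemma index_eq_sphere_nonempty: "k \<in> I \<longleftrightarrow> S k v0 \<noteq> {}"
  by (auto simp: dist_indices_def sphere_def)

lemma dist_in_index [simp]: "x \<in> V \<Longrightarrow> d v0 x \<in> I"
  by (simp add: dist_indices_def)

lemma zero_in_index [simp]: "0 \<in> I"
  using dist_in_index[OF base_point] by simp

section \<open>The index set as an initial segment\<close>

lemma Suc_index: "Suc k \<in> I \<Longrightarrow> k \<in> I"
proof -
  assume "Suc k \<in> I"
  then obtain w where w: "w \<in> V" "d v0 w = Suc k" by (auto simp: dist_indices_def)
  then obtain u where u: "(v0, u) \<in> E ^^ k" "(u, w) \<in> E"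
    using walk_dist[OF base_point, of w] by auto
  then have V: "u \<in> V" using edges by auto
  \<comment> \<open>\<open>u\<close> is the last but one vertex of a shortest walk to
    \<open>w\<close>. If it were closer to \<open>v0\<close> than \<open>k\<close>, appending the
    edge to \<open>w\<close> would give a walk shorter than \<open>d v0 w\<close>.\<close>
  have "(v0, w) \<in> E ^^ Suc (d v0 u)"
    using walk_dist[OF base_point V] u(2) by auto
  then have "d v0 u = k"
    using dist_le_walk u(1) w(2) by (metis Suc_le_mono le_antisym)
  then show "k \<in> I" using V dist_in_index by blast
qed

lemma index_downward_closed: "k \<in> I \<Longrightarrow> l \<le> k \<Longrightarrow> l \<in> I"
  by (induction k) (auto simp: le_Suc_eq dest: Suc_index)

lemma index_set_cases: "(\<exists>N. I = {0..N}) \<or> I = UNIV"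
proof (cases "finite I")
  case True
  then have "Max I \<in> I" using zero_in_index by (intro Max_in) blast+
  then have "I = {0..Max I}"
    using True by (auto intro: index_downward_closed)
  then show ?thesis by blast
next
  case False
  then have "k \<in> I" for k
    using infinite_nat_iff_unbounded_le index_downward_closed by blast
  then show ?thesis by blast
qed

section \<open>Double counting and entries of matrix products\<close>

lemma sum_card_sphere_commute:
  assumes "finite A" "finite B" "A \<subseteq> V" "B \<subseteq> V"
  shows "(\<Sum>a\<in>A. card (S j a \<inter> B)) = (\<Sum>b\<in>B. card (S j b \<inter> A))"
proof -
  \<comment> \<open>Both sides of the claim count the pairs in A x B at distance \<open>j\<close>;
    the indicator sum makes the order of summation exchangeable.\<close>
  have "(\<Sum>a\<in>A. card (S j a \<inter> B)) = (\<Sum>a\<in>A. \<Sum>b\<in>B. if d a b = j then 1 else 0)"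
    using assms by (intro sum.cong refl)
      (simp add: sum.If_cases, rule arg_cong[where f = card], auto simp: sphere_def)
  also have "\<dots> = (\<Sum>b\<in>B. \<Sum>a\<in>A. if d b a = j then 1 else 0)"
    by (subst sum.swap) (simp add: dist_commute)
  also have "\<dots> = (\<Sum>b\<in>B. card (S j b \<inter> A))"
    using assms by (intro sum.cong refl)
      (simp add: sum.If_cases, rule arg_cong[where f = card], auto simp: sphere_def)
  finally show ?thesis .
qed

text \<open>A vertex \<open>z\<close> contributes 1 exactly when it has distance \<open>k\<close>
  from \<open>x\<close> and, by symmetry of the distance, lies in the sphere of radius
  \<open>l\<close> about \<open>y\<close>.\<close>

lemma matrix_product_adjacency:
  assumes "x \<in> V" "y \<in> V"
  shows "matrix_product V (adjacency_matrix E k) (adjacency_matrix E l) x y =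
    of_nat (card (S k x \<inter> S l y))"
proof -
  have "{z \<in> V. adjacency_matrix E k x z * adjacency_matrix E l z y \<noteq> 0} = S k x \<inter> S l y"
    by (auto simp: adjacency_matrix_def sphere_def dist_commute)
  then show ?thesis
    by (simp add: matrix_product_def adjacency_matrix_def sphere_def dist_commute)
qed

section \<open>Support of the structure constants\<close>

lemma conv_coeff_nonzeroE:
  assumes "p i j k \<noteq> 0"
  obtains v w where "v \<in> S i v0" "w \<in> S j v" "w \<in> S k v0"
proof -
  have "\<exists>v\<in>S i v0. S j v \<inter> S k v0 \<noteq> {}"
    by (rule ccontr) (use assms in \<open>simp add: conv_coeff_def\<close>)
  then show ?thesis using that by blast
qed

text \<open>The vertices at distance \<open>j\<close> from some point of \<open>S i v0\<close> form
  a finite set, so its image under \<open>d v0\<close> is a finite bound for the support.\<close>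

lemma conv_coeff_support:
  assumes "p i j k \<noteq> 0"
  shows "k \<in> d v0 ` (\<Union>v\<in>S i v0. S j v)"
  using assms by (elim conv_coeff_nonzeroE) (force simp: in_sphere_iff)

lemma finite_conv_coeff_support: "finite {k. p i j k \<noteq> 0}"
proof (rule finite_subset)
  show "{k. p i j k \<noteq> 0} \<subseteq> d v0 ` (\<Union>v\<in>S i v0. S j v)"
    using conv_coeff_support by auto
  show "finite (d v0 ` (\<Union>v\<in>S i v0. S j v))"
    using base_point sphere_subset by (auto simp: subset_iff)
qed

lemma lookup_gen_conv:
  "Poly_Mapping.lookup (gen_conv V E v0 i j) k = (if k \<in> I then complex_of_real (p i j k) else 0)"
proof -
  \<comment> \<open>Over an infinite set the sum in \<open>gen_conv\<close> would take its default
    value 0.\<close>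
  have "finite {k \<in> I. p i j k \<noteq> 0}"
    by (rule finite_subset[OF _ finite_conv_coeff_support]) auto
  then show ?thesis
    by (simp add: gen_conv_def lookup_sum lookup_gen if_distrib cong: if_cong)
qed

lemma conv_coeff_nonneg: "0 \<le> p i j k"
  by (simp add: conv_coeff_def sum_nonneg)

lemma conv_free_space: "conv V E v0 f g \<in> free_space I"
  by (simp add: in_free_space_iff conv_def lookup_sum lookup_gen_conv)

end

section \<open>Structure constants under regularity and commutation\<close>

locale regular_commuting_graph = pointed_graph +
  assumes card_sphere_const: "\<lbrakk>i \<in> dist_indices V E v0; v \<in> V; w \<in> V\<rbrakk>
      \<Longrightarrow> card (sphere V E i v) = card (sphere V E i w)"
    and card_inter_const: "\<lbrakk>i \<in> dist_indices V E v0; j \<in> dist_indices V E v0;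
        k \<in> dist_indices V E v0; v \<in> sphere V E k v0; w \<in> sphere V E k v0\<rbrakk>
      \<Longrightarrow> card (sphere V E i v \<inter> sphere V E j v0) = card (sphere V E i w \<inter> sphere V E j v0)"
    and adjacency_commute: "\<lbrakk>k \<in> dist_indices V E v0; l \<in> dist_indices V E v0\<rbrakk>
      \<Longrightarrow> matrices_commute V (adjacency_matrix E k) (adjacency_matrix E l)"
begin

definition n :: "nat \<Rightarrow> nat" where "n i = card (S i v0)"

lemma card_sphere: "i \<in> I \<Longrightarrow> v \<in> V \<Longrightarrow> card (S i v) = n i"
  unfolding n_def using base_point by (intro card_sphere_const)

lemma n_pos [simp]: "i \<in> I \<Longrightarrow> n i > 0"
  using base_point by (simp add: n_def card_gt_0_iff index_eq_sphere_nonempty)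

text \<open>The two cardinalities are the \<open>(x, y)\<close> entries of the two products of
  distance matrices, which agree by hypothesis.\<close>

lemma card_inter_commute:
  assumes "k \<in> I" "l \<in> I" "x \<in> V" "y \<in> V"
  shows "card (S k x \<inter> S l y) = card (S l x \<inter> S k y)"
proof -
  have "(of_nat (card (S k x \<inter> S l y)) :: complex) = of_nat (card (S l x \<inter> S k y))"
    using adjacency_commute[OF assms(1,2)] assms(3,4)
    by (simp add: matrices_commute_def matrix_product_adjacency)
  then show ?thesis by (simp only: of_nat_eq_iff)
qed

lemma conv_coeff_eq:
  assumes "i \<in> I" "j \<in> I" "w \<in> V"
  shows "p i j (d v0 w) =
    real (n (d v0 w)) * real (card (S j w \<inter> S i v0)) / (real (n i) * real (n j))"
proof -
  let ?k = "d v0 w"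
  have w: "w \<in> S ?k v0" using assms by (simp add: in_sphere_iff)
  \<comment> \<open>Double counting moves the sum to the sphere through \<open>w\<close>, where (S2)
    makes all summands equal to the one at \<open>w\<close>.\<close>
  have "(\<Sum>v\<in>S i v0. card (S j v \<inter> S ?k v0)) = (\<Sum>v\<in>S ?k v0. card (S j v \<inter> S i v0))"
    using base_point sphere_subset by (intro sum_card_sphere_commute) auto
  also have "\<dots> = (\<Sum>v\<in>S ?k v0. card (S j w \<inter> S i v0))"
    using assms w by (intro sum.cong refl card_inter_const[of j i ?k]) auto
  finally have *: "(\<Sum>v\<in>S i v0. card (S j v \<inter> S ?k v0)) = n ?k * card (S j w \<inter> S i v0)"
    by (simp add: n_def)
  \<comment> \<open>(S1) makes the denominators independent of \<open>v\<close>.\<close>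
  have "p i j ?k = 1 / real (n i) * (\<Sum>v\<in>S i v0. real (card (S j v \<inter> S ?k v0)) / real (n j))"
    unfolding conv_coeff_def
    using assms(2) by (simp add: n_def[symmetric] in_sphere_iff card_sphere)
  also have "\<dots> = real (\<Sum>v\<in>S i v0. card (S j v \<inter> S ?k v0)) / (real (n i) * real (n j))"
    by (simp flip: sum_divide_distrib)
  finally show ?thesis by (simp only: * of_nat_mult)
qed

text \<open>In \<open>conv_coeff_eq\<close> only the intersection count could tell \<open>i\<close>
  from \<open>j\<close>, and \<open>card_inter_commute\<close> at the pair \<open>(w, v0)\<close>
  exchanges them.\<close>

lemma conv_coeff_commute:
  assumes "i \<in> I" "j \<in> I" "k \<in> I"
  shows "p i j k = p j i k"
proof -
  obtain w where w: "w \<in> V" "k = d v0 w"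
    using assms(3) by (auto simp: dist_indices_def)
  then show ?thesis
    using assms card_inter_commute[of j i w v0] base_point by (simp add: conv_coeff_eq mult.commute)
qed

lemma conv_coeff_unit_left:
  assumes "j \<in> I" "k \<in> I"
  shows "p 0 j k = (if k = j then 1 else 0)"
proof -
  have S0: "S 0 v0 = {v0}"
    using base_point dist_eq_0_iff by (auto simp: in_sphere_iff)
  have "S j v0 \<inter> S k v0 = (if k = j then S j v0 else {})"
    by (auto simp: in_sphere_iff)
  moreover have "card (S j v0) > 0" using n_pos[OF assms(1)] by (simp add: n_def)
  ultimately show ?thesis
    by (simp add: conv_coeff_def S0)
qed

text \<open>Evaluating \<open>conv_coeff_eq\<close> at \<open>w = v0\<close> leaves two spheres with
  the same centre, which meet only if their radii agree.\<close>

lemma conv_coeff_at_0: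
  assumes "i \<in> I" "j \<in> I"
  shows "p i j 0 \<noteq> 0 \<longleftrightarrow> i = j"
proof -
  have "finite (S j v0)" using base_point by simp
  moreover have "S j v0 \<inter> S i v0 \<noteq> {} \<longleftrightarrow> i = j"
    using index_eq_sphere_nonempty[of i] assms by (auto simp: in_sphere_iff)
  ultimately have "card (S j v0 \<inter> S i v0) \<noteq> 0 \<longleftrightarrow> i = j"
    by (simp add: card_eq_0_iff)
  then show ?thesis
    using conv_coeff_eq[OF assms base_point] n_pos assms zero_in_index by (simp add: neq0_conv)
qed

text \<open>For each \<open>v\<close> in \<open>S i v0\<close>, the spheres about \<open>v0\<close>
  partition \<open>S j v\<close>, so the inner fractions add up to 1 and the outer average is
  1.\<close>

lemma sum_conv_coeff:
  assumes "i \<in> I" "j \<in> I"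
  shows "(\<Sum>k\<in>{k \<in> I. p i j k \<noteq> 0}. p i j k) = 1"
proof -
  \<comment> \<open>A finite set of indices that contains the support and is large enough for the
    spheres about \<open>v0\<close> to cover every \<open>S j v\<close>.\<close>
  let ?M = "d v0 ` (\<Union>v\<in>S i v0. S j v)"
  have fin: "finite ?M" using base_point sphere_subset by (auto simp: subset_iff)
  have inner: "(\<Sum>k\<in>?M. card (S j v \<inter> S k v0)) = n j" if v: "v \<in> S i v0" for v
  proof -
    have vV: "v \<in> V" using v by (simp add: in_sphere_iff)
    have "(\<Sum>k\<in>?M. card (S j v \<inter> S k v0)) = card (\<Union>k\<in>?M. S j v \<inter> S k v0)"
      using fin vV by (intro card_UN_disjoint[symmetric]) (auto simp: in_sphere_iff)
    also have "(\<Union>k\<in>?M. S j v \<inter> S k v0) = S j v"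
      using v sphere_subset by (fastforce simp: in_sphere_iff[of _ _ v0])
    finally show ?thesis using card_sphere[OF assms(2) vV] by simp
  qed
  have "(\<Sum>k\<in>{k \<in> I. p i j k \<noteq> 0}. p i j k) = (\<Sum>k\<in>?M. p i j k)"
    using fin conv_coeff_support by (intro sum.mono_neutral_left) (auto simp: in_sphere_iff)
  also have "\<dots> = 1 / real (n i) *
      (\<Sum>k\<in>?M. \<Sum>v\<in>S i v0. real (card (S j v \<inter> S k v0)) / real (n j))"
    unfolding conv_coeff_def sum_distrib_left[symmetric]
    using assms(2) by (simp add: n_def[symmetric] in_sphere_iff card_sphere)
  also have "\<dots> = 1 / real (n i) *
      (\<Sum>v\<in>S i v0. real (\<Sum>k\<in>?M. card (S j v \<inter> S k v0)) / real (n j))"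
    by (subst sum.swap) (simp add: sum_divide_distrib)
  also have "\<dots> = 1 / real (n i) * (\<Sum>v\<in>S i v0. 1)"
    using n_pos[OF assms(2)] by (simp add: inner del: of_nat_sum)
  also have "\<dots> = 1"
    using n_pos[OF assms(1)] by (simp add: n_def)
  finally show ?thesis .
qed

text \<open>The left side is the coefficient of \<open>(x_i \<circ> x_j) \<circ> x_l\<close> at
  index \<open>d v0 w\<close>. Summing over the intermediate index \<open>m\<close> amounts to
  summing over \<open>u\<close> in \<open>S l w\<close>, grouped by distance from \<open>v0\<close>.
  The result is, up to a factor symmetric in \<open>j\<close> and \<open>l\<close>, a sum of entries
  of a product of distance matrices.\<close>

lemma sum_conv_coeff_prod:
  assumes "i \<in> I" "j \<in> I" "l \<in> I" "w \<in> V"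
  shows "(\<Sum>m\<in>{m \<in> I. p i j m \<noteq> 0}. p i j m * p m l (d v0 w)) =
    real (n (d v0 w)) / (real (n i) * real (n j) * real (n l)) *
    real (\<Sum>x\<in>S i v0. card (S j x \<inter> S l w))"
proof -
  let ?k = "d v0 w" and ?K = "{m \<in> I. p i j m \<noteq> 0}"
  \<comment> \<open>The support is enlarged by all distances occurring in \<open>S l w\<close>, so
    that the grouping reaches every \<open>u\<close>; the added terms vanish.\<close>
  let ?M = "?K \<union> d v0 ` S l w"
  let ?c = "real (n (d v0 w)) / (real (n i) * real (n j) * real (n l))"
  let ?F = "\<lambda>u. real (card (S j u \<inter> S i v0))"
  have fin: "finite ?M"
    using finite_subset[OF _ finite_conv_coeff_support, of ?K i j] assms(4) by auto
  have MI: "?M \<subseteq> I" by (auto simp: in_sphere_iff)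
  have summand: "p i j m * p m l ?k = (\<Sum>u\<in>{u \<in> S l w. d v0 u = m}. ?c * ?F u)" if m: "m \<in> I" for m
  proof -
    have eq: "{u \<in> S l w. d v0 u = m} = S l w \<inter> S m v0"
      by (auto simp: in_sphere_iff)
    have "p m l ?k = real (n ?k) / (real (n m) * real (n l)) * real (card (S l w \<inter> S m v0))"
      using conv_coeff_eq[OF m assms(3,4)] by simp
    \<comment> \<open>The cardinality is spread out as a constant sum, so that each summand can
      evaluate \<open>p i j m\<close> at its own representative \<open>u\<close>; the factor
      \<open>n m\<close> then cancels.\<close>
    then have "p i j m * p m l ?k = (\<Sum>u\<in>S l w \<inter> S m v0.
        p i j m * (real (n ?k) / (real (n m) * real (n l))))"
      by (simp add: mult_ac)
    also have "\<dots> = (\<Sum>u\<in>S l w \<inter> S m v0. ?c * ?F u)"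
    proof (rule sum.cong[OF refl])
      fix u assume "u \<in> S l w \<inter> S m v0"
      then have u: "u \<in> V" "m = d v0 u" by (auto simp: in_sphere_iff)
      show "p i j m * (real (n ?k) / (real (n m) * real (n l))) = ?c * ?F u"
        using conv_coeff_eq[OF assms(1,2) u(1)] n_pos[OF m] u(2) by (simp add: field_simps)
    qed
    finally show ?thesis by (simp only: eq)
  qed
  have "(\<Sum>m\<in>?K. p i j m * p m l ?k) = (\<Sum>m\<in>?M. p i j m * p m l ?k)"
    using fin MI by (intro sum.mono_neutral_left) auto
  also have "\<dots> = (\<Sum>m\<in>?M. \<Sum>u\<in>{u \<in> S l w. d v0 u = m}. ?c * ?F u)"
    using MI by (intro sum.cong refl summand) blast
  also have "\<dots> = (\<Sum>u\<in>S l w. ?c * ?F u)"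
    using fin assms(4) by (intro sum.group) auto
  also have "\<dots> = ?c * real (\<Sum>u\<in>S l w. card (S j u \<inter> S i v0))"
    by (simp add: sum_distrib_left)
  \<comment> \<open>A second double count brings \<open>j\<close> and \<open>l\<close> into one
    intersection, the form to which commutation of the matrices applies.\<close>
  also have "(\<Sum>u\<in>S l w. card (S j u \<inter> S i v0)) = (\<Sum>x\<in>S i v0. card (S j x \<inter> S l w))"
    using base_point assms(4) sphere_subset by (intro sum_card_sphere_commute) auto
  finally show ?thesis .
qed

section \<open>Commutativity and associativity of the convolution\<close>

lemma keys_gen_conv: "Poly_Mapping.keys (gen_conv V E v0 i j) = {k \<in> I. p i j k \<noteq> 0}"
  by (auto simp: in_keys_iff lookup_gen_conv split: if_splits)

lemma lookup_conv_gen_conv: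
  assumes "k \<in> I"
  shows "Poly_Mapping.lookup (conv V E v0 (gen_conv V E v0 i j) (gen l)) k =
    complex_of_real (\<Sum>m\<in>{m \<in> I. p i j m \<noteq> 0}. p i j m * p m l k)"
  using assms by (simp add: conv_def lookup_sum lookup_gen lookup_gen_conv keys_gen_conv)

lemma conv_gen_right_commute:
  assumes "i \<in> I" "j \<in> I" "l \<in> I"
  shows "conv V E v0 (gen_conv V E v0 i j) (gen l) = conv V E v0 (gen_conv V E v0 i l) (gen j)"
proof (rule poly_mapping_eqI)
  fix k
  show "Poly_Mapping.lookup (conv V E v0 (gen_conv V E v0 i j) (gen l)) k =
      Poly_Mapping.lookup (conv V E v0 (gen_conv V E v0 i l) (gen j)) k"
  proof (cases "k \<in> I")
    case True
    then obtain w where w: "w \<in> V" "k = d v0 w" by (auto simp: dist_indices_def)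
    \<comment> \<open>Commutation is used here at \<open>(x, w)\<close> for every \<open>x\<close>
      in the sphere, not only at the base point.\<close>
    have "(\<Sum>x\<in>S i v0. card (S j x \<inter> S l w)) = (\<Sum>x\<in>S i v0. card (S l x \<inter> S j w))"
      using assms w by (intro sum.cong refl card_inter_commute) (auto simp: in_sphere_iff)
    then show ?thesis
      using assms w
      by (simp add: lookup_conv_gen_conv sum_conv_coeff_prod mult_ac del: of_nat_sum of_real_sum)
  next
    case False
    then show ?thesis
      using conv_free_space by (metis in_free_space_iff)
  qed
qed

lemma gen_conv_commute:
  "i \<in> I \<Longrightarrow> j \<in> I \<Longrightarrow> gen_conv V E v0 i j = gen_conv V E v0 j i"
  by (rule poly_mapping_eqI) (simp add: lookup_gen_conv conv_coeff_commute)

lemma conv_commute: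
  assumes "f \<in> free_space I" "g \<in> free_space I"
  shows "conv V E v0 f g = conv V E v0 g f"
  using assms(1)
proof (induction rule: free_space_induct)
  case (gen i)
  show ?case using assms(2)
    by (induction rule: free_space_induct)
       (simp_all add: conv_linear_simps gen gen_conv_commute)
qed (simp_all add: conv_linear_simps)

text \<open>Swap \<open>i\<close> and \<open>j\<close>, exchange the two right factors
  \<open>i\<close> and \<open>l\<close>, then move \<open>i\<close> to the front by
  commutativity.\<close>

lemma conv_assoc_gen:
  assumes "i \<in> I" "j \<in> I" "l \<in> I"
  shows "conv V E v0 (gen_conv V E v0 i j) (gen l) = conv V E v0 (gen i) (gen_conv V E v0 j l)"
proof -
  have "conv V E v0 (gen_conv V E v0 i j) (gen l) = conv V E v0 (gen_conv V E v0 j i) (gen l)"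
    using assms by (simp add: gen_conv_commute)
  also have "\<dots> = conv V E v0 (gen_conv V E v0 j l) (gen i)"
    using assms by (intro conv_gen_right_commute)
  also have "\<dots> = conv V E v0 (gen i) (gen_conv V E v0 j l)"
    using assms conv_free_space[of "gen j" "gen l"] by (intro conv_commute) auto
  finally show ?thesis .
qed

lemma conv_assoc:
  assumes "f \<in> free_space I" "g \<in> free_space I" "h \<in> free_space I"
  shows "conv V E v0 (conv V E v0 f g) h = conv V E v0 f (conv V E v0 g h)"
  using assms(1)
proof (induction rule: free_space_induct)
  case (gen i)
  show ?case using assms(2)
  proof (induction rule: free_space_induct)
    case (gen j)
    show ?case using assms(3)
      by (induction rule: free_space_induct)
         (simp_all add: conv_linear_simps conv_assoc_gen \<open>i \<in> I\<close> \<open>j \<in> I\<close>)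
  qed (simp_all add: conv_linear_simps)
qed (simp_all add: conv_linear_simps)

section \<open>Unit, involution and the hypergroup axioms\<close>

lemma conv_unit_left:
  assumes "f \<in> free_space I"
  shows "conv V E v0 (gen 0) f = f"
  using assms
proof (induction rule: free_space_induct)
  case (gen i)
  then show ?case
    by (intro poly_mapping_eqI) (auto simp: lookup_gen_conv lookup_gen conv_coeff_unit_left)
qed (simp_all add: conv_linear_simps)

text \<open>The structure constants are real, so conjugating coefficients preserves products;
  commutativity later supplies the reversed order of a *-algebra.\<close>

lemma conj_star_conv: "conj_star (conv V E v0 f g) = conv V E v0 (conj_star f) (conj_star g)"
proof (rule poly_mapping_eqI)
  fix k
  have "Poly_Mapping.keys (conj_star h) = Poly_Mapping.keys h" for h
    by (auto simp: in_keys_iff)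
  then show "Poly_Mapping.lookup (conj_star (conv V E v0 f g)) k =
      Poly_Mapping.lookup (conv V E v0 (conj_star f) (conj_star g)) k"
    by (cases "k \<in> I") (simp_all add: conv_def lookup_sum lookup_gen_conv)
qed

lemma hypergroup_productive: "hypergroup_productive V E v0"
  unfolding hypergroup_productive_def
proof unfold_locales
  fix f g h :: "nat \<Rightarrow>\<^sub>0 complex" and c :: complex
  assume f: "f \<in> free_space I"
  show "conv V E v0 (scale c f) g = scale c (conv V E v0 f g)"
    by (rule conv_scale_left)
  show "conv V E v0 f (scale c g) = scale c (conv V E v0 f g)"
    by (rule conv_scale_right)
  show "conv V E v0 (gen 0) f = f"
    using f by (rule conv_unit_left)
  then show "conv V E v0 f (gen 0) = f"
    using f conv_commute[of f "gen 0"] by simp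
  show "conj_star (conj_star f) = f"
    by (rule poly_mapping_eqI) simp
  assume g: "g \<in> free_space I"
  show "conj_star (conv V E v0 f g) = conv V E v0 (conj_star g) (conj_star f)"
    using f g by (simp add: conj_star_conv conv_commute)
next
  fix i j assume ij: "i \<in> I" "j \<in> I"
  have "(\<Sum>k\<in>{k \<in> I. p i j k \<noteq> 0}. complex_of_real (p i j k)) = 1"
    using sum_conv_coeff[OF ij] by (simp flip: of_real_sum)
  then show "(\<Sum>k\<in>Poly_Mapping.keys (conv V E v0 (gen i) (gen j)).
      Poly_Mapping.lookup (conv V E v0 (gen i) (gen j)) k) = 1"
    by (simp add: keys_gen_conv lookup_gen_conv)
  show "Poly_Mapping.lookup (conv V E v0 (gen i) (gen j)) 0 \<noteq> 0 \<longleftrightarrow> gen i = conj_star (gen j)"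
    using conv_coeff_at_0[OF ij] by (simp add: lookup_gen_conv)
qed (auto simp: conv_free_space conv_add_left conv_add_right conv_assoc conj_star_add
    conj_star_scale index_set_cases lookup_gen_conv conv_coeff_nonneg image_image)

end

theorem corollary3p10:
  fixes V :: "'a set" and E :: "('a \<times> 'a) set" and v0 :: 'a
  assumes graph: "pointed_graph V E v0"
    and S1: "\<And>i v w. \<lbrakk>i \<in> dist_indices V E v0; v \<in> V; w \<in> V\<rbrakk>
      \<Longrightarrow> card (sphere V E i v) = card (sphere V E i w)"
    and S2: "\<And>i j k v w. \<lbrakk>i \<in> dist_indices V E v0; j \<in> dist_indices V E v0;
        k \<in> dist_indices V E v0; v \<in> sphere V E k v0; w \<in> sphere V E k v0\<rbrakk>
      \<Longrightarrow> card (sphere V E i v \<inter> sphere V E j v0) = card (sphere V E i w \<inter> sphere V E j v0)"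
    and commute: "\<And>k l. \<lbrakk>k \<in> dist_indices V E v0; l \<in> dist_indices V E v0\<rbrakk>
      \<Longrightarrow> matrices_commute V (adjacency_matrix E k) (adjacency_matrix E l)"
  shows "hypergroup_productive V E v0"
proof -
  interpret pointed_graph V E v0 by (fact graph)
  interpret regular_commuting_graph V E v0
    by unfold_locales (fact S1, fact S2, fact commute)
  show ?thesis by (rule hypergroup_productive)
qed

end
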